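(* Let $(X,\tau)$ be a topological space, let $\varphi_1,\varphi_2\in O(X,\tau)$, and let $\mathcal{B}=\{\varphi_2(U):U\in\varphi_1O(X)\}$. Suppose that ($\varphi_2\geq\varphi_1$ or $\varphi_2\geq\imath$), and that for each $U\in\varphi_1O(X)$ we have $\varphi_2(U)\in\varphi_1O(X)$ and $\varphi_2(\varphi_2(U))\subset\varphi_2(U)$. Then the following are equivalent for any subset $A$ of $X$: (a) $A$ is a $\varphi_{1,2}$-compact set. (b) $A$ is a $\mathcal{B}$-compact set. (c) $A$ is a $\varphi_{1,2}O(X)$-compact set. (d) If $W$ is any subfamily of $\{X\setminus\varphi_2(U):U\in\varphi_1O(X)\}$ such that $A\cap(\bigcap W')\neq\emptyset$ for each finite subfamily $W'$ of $W$, then $A\cap(\bigcap W)\neq\emptyset$. (e) If $W$ is any subfamily of $\{X\setminus\varphi_2(U):U\in\varphi_1O(X)\}$ with $A\cap(\bigcap W)=\emptyset$, then there exists a finite subfamily $W'$ of $W$ such that $A\cap(\bigcap W')=\emptyset$. (f) If $W$ is any subfamily of $\{X\setminus U:U\in\varphi_{1,2}O(X)\}$ such that $A\cap(\bigcap W')\neq\emptyset$ for each finite subfamily $W'$ of $W$, then $A\cap(\bigcap W)\neq\emptyset$. (g) If $W$ is any subfamily of $\{X\setminus U:U\in\varphi_{1,2}O(X)\}$ such that $A\cap(\bigcap W)=\emptyset$, then there exists a finite subfamily $W'$ of $W$ such that $A\cap(\bigcap W')=\emptyset$.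
   Context: Let $(X,\tau)$ be a topological space and let $A^{o}$ denote the interior of $A\subset X$. An operation on $(X,\tau)$ is a map $\varphi:P(X)\to P(X)$ with $A^{o}\subset\varphi(A)$ for all $A\in P(X)$ and $\varphi(\emptyset)=\emptyset$; $O(X,\tau)$ is the set of all operations, partially ordered by $\varphi\leq\psi$ iff $\varphi(A)\subset\psi(A)$ for all $A\in P(X)$. $\imath$ is the identity operation. A set $A\subset X$ is $\varphi$-open if $A\subset\varphi(A)$; $\varphi O(X)$ is the family of all $\varphi$-open sets. For $A\subset X$: $x\in\varphi_{1,2}\mathrm{int}\,A$ iff there is $U\in\varphi_1O(X)$ with $x\in U$ and $\varphi_2(U)\subset A$. $A$ is $\varphi_{1,2}$-open if $A\subset\varphi_{1,2}\mathrm{int}\,A$; $\varphi_{1,2}O(X)$ is the family of $\varphi_{1,2}$-open sets. A set $A\subset X$ is a $\varphi_{1,2}$-compact set (relative to $X$) if every family $\mathcal{U}\subset\varphi_1O(X)$ with $A\subset\bigcup\mathcal{U}$ has a finite subfamily $\mathcal{U}'$ with $A\subset\bigcup\{\varphi_2(U):U\in\mathcal{U}'\}$. For a family $\mathcal{A}\subset P(X)$ with $X\in\mathcal{A}$, $A$ is an $\mathcal{A}$-compact set if every family $\mathcal{U}\subset\mathcal{A}$ with $A\subset\bigcup\mathcal{U}$ has a finite subfamily $\mathcal{U}'$ with $A\subset\bigcup\mathcal{U}'$. Intersections of subfamilies are taken within $X$ (the empty intersection is $X$). *)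

theory Defs
  imports "HOL-Analysis.Abstract_Topology"
begin

text \<open>
  The space is a topology \<open>T\<close> with carrier \<open>topspace T\<close>, which need not be all of the type.
  An operation is a HOL function of which only the values on subsets of \<open>topspace T\<close> matter;
  its values elsewhere are unconstrained, and no notion below depends on them.
\<close>

definition operation_on :: "'a topology \<Rightarrow> ('a set \<Rightarrow> 'a set) \<Rightarrow> bool" where
  "operation_on T \<phi> \<longleftrightarrow>
     \<phi> \<in> Pow (topspace T) \<rightarrow> Pow (topspace T) \<and>
     (\<forall>A \<in> Pow (topspace T). T interior_of A \<subseteq> \<phi> A) \<and>
     \<phi> {} = {}"

definition op_le :: "'a topology \<Rightarrow> ('a set \<Rightarrow> 'a set) \<Rightarrow> ('a set \<Rightarrow> 'a set) \<Rightarrow> bool" where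
  "op_le T \<phi> \<psi> \<longleftrightarrow> (\<forall>A \<in> Pow (topspace T). \<phi> A \<subseteq> \<psi> A)"

definition op_opens :: "'a topology \<Rightarrow> ('a set \<Rightarrow> 'a set) \<Rightarrow> 'a set set" where
  "op_opens T \<phi> = {A. A \<subseteq> topspace T \<and> A \<subseteq> \<phi> A}"

definition op2_int ::
    "'a topology \<Rightarrow> ('a set \<Rightarrow> 'a set) \<Rightarrow> ('a set \<Rightarrow> 'a set) \<Rightarrow> 'a set \<Rightarrow> 'a set" where
  "op2_int T \<phi>1 \<phi>2 A = {x. \<exists>U \<in> op_opens T \<phi>1. x \<in> U \<and> \<phi>2 U \<subseteq> A}"

definition op2_opens ::
    "'a topology \<Rightarrow> ('a set \<Rightarrow> 'a set) \<Rightarrow> ('a set \<Rightarrow> 'a set) \<Rightarrow> 'a set set" where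
  "op2_opens T \<phi>1 \<phi>2 = {A. A \<subseteq> topspace T \<and> A \<subseteq> op2_int T \<phi>1 \<phi>2 A}"

definition op2_compact_set ::
    "'a topology \<Rightarrow> ('a set \<Rightarrow> 'a set) \<Rightarrow> ('a set \<Rightarrow> 'a set) \<Rightarrow> 'a set \<Rightarrow> bool" where
  "op2_compact_set T \<phi>1 \<phi>2 A \<longleftrightarrow>
     A \<subseteq> topspace T \<and>
     (\<forall>\<U>. \<U> \<subseteq> op_opens T \<phi>1 \<and> A \<subseteq> \<Union>\<U> \<longrightarrow>
        (\<exists>\<U>'. finite \<U>' \<and> \<U>' \<subseteq> \<U> \<and> A \<subseteq> (\<Union>U \<in> \<U>'. \<phi>2 U)))"

text \<open>
  The next notion is meant for families \<open>\<A>\<close> of subsets of the space that contain the whole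
  space; the two lemmas at the end show that the families of interest are of this kind.
\<close>

definition family_compact_set :: "'a topology \<Rightarrow> 'a set set \<Rightarrow> 'a set \<Rightarrow> bool" where
  "family_compact_set T \<A> A \<longleftrightarrow>
     A \<subseteq> topspace T \<and>
     (\<forall>\<U>. \<U> \<subseteq> \<A> \<and> A \<subseteq> \<Union>\<U> \<longrightarrow>
        (\<exists>\<U>'. finite \<U>' \<and> \<U>' \<subseteq> \<U> \<and> A \<subseteq> \<Union>\<U>'))"

text \<open>Intersection within the space, so that the empty intersection is \<open>topspace T\<close>, not \<open>UNIV\<close>.\<close>

definition Inter_in :: "'a topology \<Rightarrow> 'a set set \<Rightarrow> 'a set" where
  "Inter_in T W = topspace T \<inter> \<Inter>W"

lemma operation_on_topspace:
  assumes "operation_on T \<phi>"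
  shows "\<phi> (topspace T) = topspace T" and "topspace T \<in> op_opens T \<phi>"
proof -
  show *: "\<phi> (topspace T) = topspace T"
  proof
    show "\<phi> (topspace T) \<subseteq> topspace T"
      using assms unfolding operation_on_def by (meson PiE Pow_iff order_refl)
    have "T interior_of topspace T \<subseteq> \<phi> (topspace T)"
      using assms unfolding operation_on_def by blast
    then show "topspace T \<subseteq> \<phi> (topspace T)"
      by simp
  qed
  show "topspace T \<in> op_opens T \<phi>"
    by (simp add: op_opens_def *)
qed

lemma image_op_opens_family:
  assumes "operation_on T \<phi>1" "operation_on T \<phi>2"
  shows "\<phi>2 ` op_opens T \<phi>1 \<subseteq> Pow (topspace T)"
    and "topspace T \<in> \<phi>2 ` op_opens T \<phi>1"
proof -
  show "\<phi>2 ` op_opens T \<phi>1 \<subseteq> Pow (topspace T)"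
    using assms(2) by (auto simp: operation_on_def op_opens_def Pi_iff)
  show "topspace T \<in> \<phi>2 ` op_opens T \<phi>1"
    using operation_on_topspace[OF assms(1)] operation_on_topspace[OF assms(2)]
    by (metis image_eqI)
qed

lemma op2_opens_family:
  assumes "operation_on T \<phi>1" "operation_on T \<phi>2"
  shows "op2_opens T \<phi>1 \<phi>2 \<subseteq> Pow (topspace T)"
    and "topspace T \<in> op2_opens T \<phi>1 \<phi>2"
proof -
  show "op2_opens T \<phi>1 \<phi>2 \<subseteq> Pow (topspace T)"
    by (auto simp: op2_opens_def)
  show "topspace T \<in> op2_opens T \<phi>1 \<phi>2"
    using operation_on_topspace[OF assms(1)] operation_on_topspace[OF assms(2)]
    by (auto simp: op2_opens_def op2_int_def)
qed

end

theory Submission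
  imports Defs
begin

text \<open>
  Under the hypotheses \<open>U \<subseteq> \<phi>2 U\<close> for every \<open>\<phi>1\<close>-open \<open>U\<close>, so \<open>\<phi>2\<close> fixes every member of \<open>\<B>\<close>; this
  lets covers by \<open>\<phi>1\<close>-open sets and covers by members of \<open>\<B>\<close> be exchanged.  Moreover \<open>\<B>\<close> consists of
  \<open>\<phi>1,2\<close>-open sets and is a base for them, so refining covers gives (b) \<open>\<longleftrightarrow>\<close> (c).  The remaining
  conditions are obtained by passing to complements.
\<close>

text \<open>De Morgan inside the space: a point of \<open>A\<close> lies in every complement exactly
  when it lies in no member of \<open>\<U>\<close>. Since \<open>A\<close> lies in the carrier, the
  carrier factor of \<open>Inter_in\<close> is harmless; for empty \<open>\<U>\<close> both sides
  say that \<open>A\<close> is empty.\<close>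

lemma disjoint_Inter_in_complements_iff:
  assumes "A \<subseteq> topspace T"
  shows "A \<inter> Inter_in T ((-) (topspace T) ` \<U>) = {} \<longleftrightarrow> A \<subseteq> \<Union>\<U>"
  using assms by (auto simp: Inter_in_def)

text \<open>Complementation carries subfamilies of \<open>\<A>\<close> to the admissible
  \<open>W\<close>, and covers of \<open>A\<close> to families whose intersection misses
  \<open>A\<close>. Used with \<open>\<B>\<close> for (e) and with the \<phi>1,2-open sets for
  (g).\<close>

lemma family_compact_set_iff_complements:
  assumes A: "A \<subseteq> topspace T"
  shows "family_compact_set T \<A> A \<longleftrightarrow>
    (\<forall>W. W \<subseteq> {topspace T - U | U. U \<in> \<A>} \<and> A \<inter> Inter_in T W = {} \<longrightarrow>
       (\<exists>W'. finite W' \<and> W' \<subseteq> W \<and> A \<inter> Inter_in T W' = {}))"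
    (is "_ \<longleftrightarrow> ?closed")
proof -
  have image: "{topspace T - U | U. U \<in> \<A>} = (-) (topspace T) ` \<A>"
    by blast
  show ?thesis
  proof
    assume compact: "family_compact_set T \<A> A"
    show ?closed
    proof (intro allI impI)
      fix W assume W: "W \<subseteq> {topspace T - U | U. U \<in> \<A>} \<and> A \<inter> Inter_in T W = {}"
      then obtain \<U> where \<U>: "\<U> \<subseteq> \<A>" "W = (-) (topspace T) ` \<U>"
        unfolding image subset_image_iff by blast
      with W have "A \<subseteq> \<Union>\<U>"
        using disjoint_Inter_in_complements_iff[OF A] by simp
      with compact \<U> obtain \<U>' where "finite \<U>'" "\<U>' \<subseteq> \<U>" "A \<subseteq> \<Union>\<U>'"
        unfolding family_compact_set_def by meson
      then show "\<exists>W'. finite W' \<and> W' \<subseteq> W \<and> A \<inter> Inter_in T W' = {}"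
        using disjoint_Inter_in_complements_iff[OF A] \<U>(2)
        by (intro exI[of _ "(-) (topspace T) ` \<U>'"]) (simp add: image_mono)
    qed
  next
    assume closed: ?closed
    show "family_compact_set T \<A> A"
      unfolding family_compact_set_def
    proof (intro conjI allI impI A)
      fix \<U> assume \<U>: "\<U> \<subseteq> \<A> \<and> A \<subseteq> \<Union>\<U>"
      then have "(-) (topspace T) ` \<U> \<subseteq> {topspace T - U | U. U \<in> \<A>}"
        unfolding image by (simp add: image_mono)
      moreover have "A \<inter> Inter_in T ((-) (topspace T) ` \<U>) = {}"
        using disjoint_Inter_in_complements_iff[OF A] \<U> by simp
      ultimately obtain W' where "finite W'" "W' \<subseteq> (-) (topspace T) ` \<U>"
        and W': "A \<inter> Inter_in T W' = {}"
        using closed by meson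
      \<comment> \<open>One preimage is picked for each of the finitely many members of
        \<open>W'\<close>, so injectivity of complementation is not at issue.\<close>
      then obtain \<U>' where "\<U>' \<subseteq> \<U>" "finite \<U>'" "W' = (-) (topspace T) ` \<U>'"
        using finite_subset_image by metis
      then show "\<exists>\<U>'. finite \<U>' \<and> \<U>' \<subseteq> \<U> \<and> A \<subseteq> \<Union>\<U>'"
        using W' disjoint_Inter_in_complements_iff[OF A] by metis
    qed
  qed
qed

lemma family_compact_set_antimono:
  "family_compact_set T \<B> A \<Longrightarrow> \<A> \<subseteq> \<B> \<Longrightarrow> family_compact_set T \<A> A"
  unfolding family_compact_set_def by (meson subset_trans)

text \<open>Refine the given cover to members of \<open>\<B>\<close>, extract a finite subcover
  there, and enlarge each of its sets to a member of the original cover.\<close>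

lemma family_compact_set_base:
  assumes compact: "family_compact_set T \<B> A"
    and base: "\<And>C x. C \<in> \<C> \<Longrightarrow> x \<in> C \<Longrightarrow> \<exists>B\<in>\<B>. x \<in> B \<and> B \<subseteq> C"
  shows "family_compact_set T \<C> A"
  unfolding family_compact_set_def
proof (intro conjI allI impI)
  show "A \<subseteq> topspace T"
    using compact by (simp add: family_compact_set_def)
next
  fix \<U> assume \<U>: "\<U> \<subseteq> \<C> \<and> A \<subseteq> \<Union>\<U>"
  \<comment> \<open>Taking all basic sets that fit inside some member of the cover avoids choosing
    one for each point of \<open>A\<close>.\<close>
  define \<V> where "\<V> = {B \<in> \<B>. \<exists>U\<in>\<U>. B \<subseteq> U}"
  have "\<V> \<subseteq> \<B>"
    by (auto simp: \<V>_def)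
  moreover have "A \<subseteq> \<Union>\<V>"
  proof
    fix x assume "x \<in> A"
    with \<U> obtain U where "U \<in> \<U>" "U \<in> \<C>" "x \<in> U"
      by blast
    with base show "x \<in> \<Union>\<V>"
      unfolding \<V>_def by blast
  qed
  ultimately obtain \<V>' where \<V>': "finite \<V>'" "\<V>' \<subseteq> \<V>" "A \<subseteq> \<Union>\<V>'"
    using compact unfolding family_compact_set_def by meson
  then have "\<forall>B\<in>\<V>'. \<exists>U\<in>\<U>. B \<subseteq> U"
    by (auto simp: \<V>_def)
  then obtain f where f: "\<And>B. B \<in> \<V>' \<Longrightarrow> f B \<in> \<U> \<and> B \<subseteq> f B"
    by metis
  have "A \<subseteq> \<Union>(f ` \<V>')"
  proof
    fix x assume "x \<in> A"
    with \<V>'(3) obtain B where B: "B \<in> \<V>'" "x \<in> B"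
      by blast
    with f[OF B(1)] show "x \<in> \<Union>(f ` \<V>')"
      by blast
  qed
  moreover have "f ` \<V>' \<subseteq> \<U>"
    using f by (simp add: image_subset_iff)
  ultimately show "\<exists>\<U>'. finite \<U>' \<and> \<U>' \<subseteq> \<U> \<and> A \<subseteq> \<Union>\<U>'"
    using \<V>'(1) by (intro exI[of _ "f ` \<V>'"]) simp
qed

text \<open>Under the first alternative,
  \<open>U \<subseteq> \<phi>1 U \<subseteq> \<phi>2 U\<close>; the second gives the inclusion at
  once.\<close>

lemma op_opens_subset_op:
  assumes "op_le T \<phi>1 \<phi>2 \<or> op_le T id \<phi>2" "U \<in> op_opens T \<phi>1"
  shows "U \<subseteq> \<phi>2 U"
  using assms unfolding op_le_def op_opens_def by auto

text \<open>Forwards, a cover from the image already consists of \<phi>1-open sets that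
  \<open>\<phi>2\<close> does not enlarge. Backwards, \<open>expand\<close> makes the image under
  \<open>\<phi>2\<close> of a \<phi>1-open cover a cover again.\<close>

lemma op2_compact_set_iff_family_compact_set_image:
  assumes expand: "\<And>U. U \<in> op_opens T \<phi>1 \<Longrightarrow> U \<subseteq> \<phi>2 U"
    and closed: "\<And>U. U \<in> op_opens T \<phi>1 \<Longrightarrow> \<phi>2 U \<in> op_opens T \<phi>1 \<and> \<phi>2 (\<phi>2 U) \<subseteq> \<phi>2 U"
  shows "op2_compact_set T \<phi>1 \<phi>2 A \<longleftrightarrow> family_compact_set T (\<phi>2 ` op_opens T \<phi>1) A"
proof
  assume compact: "op2_compact_set T \<phi>1 \<phi>2 A"
  show "family_compact_set T (\<phi>2 ` op_opens T \<phi>1) A"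
    unfolding family_compact_set_def
  proof (intro conjI allI impI)
    show "A \<subseteq> topspace T"
      using compact by (simp add: op2_compact_set_def)
  next
    fix \<V> assume \<V>: "\<V> \<subseteq> \<phi>2 ` op_opens T \<phi>1 \<and> A \<subseteq> \<Union>\<V>"
    with closed have "\<V> \<subseteq> op_opens T \<phi>1"
      by blast
    with compact \<V> obtain \<V>' where \<V>': "finite \<V>'" "\<V>' \<subseteq> \<V>" "A \<subseteq> (\<Union>V\<in>\<V>'. \<phi>2 V)"
      unfolding op2_compact_set_def by meson
    \<comment> \<open>Write \<open>V = \<phi>2 U\<close> with \<open>U\<close> \<phi>1-open and
      apply the second half of \<open>closed\<close> to \<open>U\<close>.\<close>
    moreover have "\<phi>2 V \<subseteq> V" if "V \<in> \<V>'" for V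
      using that \<V> \<V>'(2) closed by blast
    ultimately show "\<exists>\<V>'. finite \<V>' \<and> \<V>' \<subseteq> \<V> \<and> A \<subseteq> \<Union>\<V>'"
      by (intro exI[of _ \<V>']) blast
  qed
next
  assume compact: "family_compact_set T (\<phi>2 ` op_opens T \<phi>1) A"
  show "op2_compact_set T \<phi>1 \<phi>2 A"
    unfolding op2_compact_set_def
  proof (intro conjI allI impI)
    show "A \<subseteq> topspace T"
      using compact by (simp add: family_compact_set_def)
  next
    fix \<U> assume \<U>: "\<U> \<subseteq> op_opens T \<phi>1 \<and> A \<subseteq> \<Union>\<U>"
    then have "\<phi>2 ` \<U> \<subseteq> \<phi>2 ` op_opens T \<phi>1" "A \<subseteq> \<Union>(\<phi>2 ` \<U>)"
      using expand by blast+
    with compact obtain \<V>' where "finite \<V>'" "\<V>' \<subseteq> \<phi>2 ` \<U>" and A: "A \<subseteq> \<Union>\<V>'"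
      unfolding family_compact_set_def by meson
    then obtain \<U>' where "\<U>' \<subseteq> \<U>" "finite \<U>'" "\<V>' = \<phi>2 ` \<U>'"
      using finite_subset_image by metis
    with A show "\<exists>\<U>'. finite \<U>' \<and> \<U>' \<subseteq> \<U> \<and> A \<subseteq> (\<Union>U\<in>\<U>'. \<phi>2 U)"
      by blast
  qed
qed

text \<open>A set \<open>V\<close> in the image is its own witness at each of its points: it is
  \<phi>1-open and \<open>\<phi>2 V \<subseteq> V\<close>.\<close>

lemma image_op_opens_subset_op2_opens:
  assumes "\<And>U. U \<in> op_opens T \<phi>1 \<Longrightarrow> \<phi>2 U \<in> op_opens T \<phi>1 \<and> \<phi>2 (\<phi>2 U) \<subseteq> \<phi>2 U"
  shows "\<phi>2 ` op_opens T \<phi>1 \<subseteq> op2_opens T \<phi>1 \<phi>2"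
proof
  fix V assume "V \<in> \<phi>2 ` op_opens T \<phi>1"
  with assms have V: "V \<in> op_opens T \<phi>1" "\<phi>2 V \<subseteq> V"
    by blast+
  then have "V \<subseteq> topspace T"
    by (simp add: op_opens_def)
  with V show "V \<in> op2_opens T \<phi>1 \<phi>2"
    unfolding op2_opens_def op2_int_def by blast
qed

theorem theorem3p6:
  fixes T :: "'a topology"
    and \<phi>1 \<phi>2 :: "'a set \<Rightarrow> 'a set"
    and \<B> :: "'a set set"
    and A :: "'a set"
  assumes "operation_on T \<phi>1"
    and "operation_on T \<phi>2"
    and "\<B> = {\<phi>2 U | U. U \<in> op_opens T \<phi>1}"
    and "op_le T \<phi>1 \<phi>2 \<or> op_le T id \<phi>2"
    and "\<And>U. U \<in> op_opens T \<phi>1 \<Longrightarrow> \<phi>2 U \<in> op_opens T \<phi>1 \<and> \<phi>2 (\<phi>2 U) \<subseteq> \<phi>2 U"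
    and "A \<subseteq> topspace T"
  shows
    "(op2_compact_set T \<phi>1 \<phi>2 A \<longleftrightarrow> family_compact_set T \<B> A) \<and>
     (op2_compact_set T \<phi>1 \<phi>2 A \<longleftrightarrow> family_compact_set T (op2_opens T \<phi>1 \<phi>2) A) \<and>
     (op2_compact_set T \<phi>1 \<phi>2 A \<longleftrightarrow>
        (\<forall>W. W \<subseteq> {topspace T - \<phi>2 U | U. U \<in> op_opens T \<phi>1} \<and>
             (\<forall>W'. finite W' \<and> W' \<subseteq> W \<longrightarrow> A \<inter> Inter_in T W' \<noteq> {}) \<longrightarrow>
             A \<inter> Inter_in T W \<noteq> {})) \<and>
     (op2_compact_set T \<phi>1 \<phi>2 A \<longleftrightarrow>
        (\<forall>W. W \<subseteq> {topspace T - \<phi>2 U | U. U \<in> op_opens T \<phi>1} \<and>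
             A \<inter> Inter_in T W = {} \<longrightarrow>
             (\<exists>W'. finite W' \<and> W' \<subseteq> W \<and> A \<inter> Inter_in T W' = {}))) \<and>
     (op2_compact_set T \<phi>1 \<phi>2 A \<longleftrightarrow>
        (\<forall>W. W \<subseteq> {topspace T - U | U. U \<in> op2_opens T \<phi>1 \<phi>2} \<and>
             (\<forall>W'. finite W' \<and> W' \<subseteq> W \<longrightarrow> A \<inter> Inter_in T W' \<noteq> {}) \<longrightarrow>
             A \<inter> Inter_in T W \<noteq> {})) \<and>
     (op2_compact_set T \<phi>1 \<phi>2 A \<longleftrightarrow>
        (\<forall>W. W \<subseteq> {topspace T - U | U. U \<in> op2_opens T \<phi>1 \<phi>2} \<and>
             A \<inter> Inter_in T W = {} \<longrightarrow>
             (\<exists>W'. finite W' \<and> W' \<subseteq> W \<and> A \<inter> Inter_in T W' = {})))"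
proof -
  have expand: "U \<subseteq> \<phi>2 U" if "U \<in> op_opens T \<phi>1" for U
    using op_opens_subset_op[OF assms(4) that] .
  have \<B>: "\<B> = \<phi>2 ` op_opens T \<phi>1"
    using assms(3) by blast
  have ab: "op2_compact_set T \<phi>1 \<phi>2 A \<longleftrightarrow> family_compact_set T \<B> A"
    unfolding \<B> using expand assms(5) by (rule op2_compact_set_iff_family_compact_set_image)
  have bc: "family_compact_set T \<B> A \<longleftrightarrow> family_compact_set T (op2_opens T \<phi>1 \<phi>2) A"
  proof
    assume "family_compact_set T \<B> A"
    then show "family_compact_set T (op2_opens T \<phi>1 \<phi>2) A"
    proof (rule family_compact_set_base)
      fix C x assume "C \<in> op2_opens T \<phi>1 \<phi>2" "x \<in> C"
      \<comment> \<open>The basic set around \<open>x\<close> is \<open>\<phi>2 U\<close>: it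
        contains \<open>x\<close> because \<open>U \<subseteq> \<phi>2 U\<close>.\<close>
      then obtain U where "U \<in> op_opens T \<phi>1" "x \<in> U" "\<phi>2 U \<subseteq> C"
        unfolding op2_opens_def op2_int_def by blast
      with expand show "\<exists>B\<in>\<B>. x \<in> B \<and> B \<subseteq> C"
        unfolding \<B> by blast
    qed
  next
    assume "family_compact_set T (op2_opens T \<phi>1 \<phi>2) A"
    then show "family_compact_set T \<B> A"
      using image_op_opens_subset_op2_opens[OF assms(5)] unfolding \<B>
      by (rule family_compact_set_antimono)
  qed
  have \<B>_complements:
    "{topspace T - \<phi>2 U | U. U \<in> op_opens T \<phi>1} = {topspace T - V | V. V \<in> \<B>}"
    unfolding \<B> by blast
  note be = family_compact_set_iff_complements[OF assms(6), of \<B>]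
  note cg = family_compact_set_iff_complements[OF assms(6), of "op2_opens T \<phi>1 \<phi>2"]
  \<comment> \<open>Stated for an arbitrary family \<open>\<W>\<close>, so that it settles both (d)
    against (e) and (f) against (g).\<close>
  have contrapositive:
    "(\<forall>W. W \<subseteq> \<W> \<and> (\<forall>W'. finite W' \<and> W' \<subseteq> W \<longrightarrow> A \<inter> Inter_in T W' \<noteq> {}) \<longrightarrow>
          A \<inter> Inter_in T W \<noteq> {}) \<longleftrightarrow>
     (\<forall>W. W \<subseteq> \<W> \<and> A \<inter> Inter_in T W = {} \<longrightarrow>
          (\<exists>W'. finite W' \<and> W' \<subseteq> W \<and> A \<inter> Inter_in T W' = {}))" for \<W>
    by (rule iff_allI) blast
  show ?thesis
    \<comment> \<open>The rewriting reduces (d) and (e) to (b), and (f) and (g) to (c), so that only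
      \<open>ab\<close> and \<open>bc\<close> remain to be combined.\<close>
    unfolding \<B>_complements contrapositive be[symmetric] cg[symmetric]
    using ab bc by simp
qed

end
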